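(* Consider a constellation of $N_{\mathrm{act}}$ satellites. Let the effective number of satellites, $N_{\mathrm{eff}}$, be the constellation size that corresponds to a satellite density observed by a user on a specific latitude assuming the same density continues everywhere. The effective number of satellites can then be determined as $$N_{\mathrm{eff}}\triangleq\frac{2\,f_{\Phi_{\mathrm{s}}}(\phi_{\mathrm{s}})}{\cos(\phi_{\mathrm{s}})}\cdot N_{\mathrm{act}},$$ where the random variable $\Phi_{\mathrm{s}}$ denotes the latitude of a satellite and $f_{\Phi_{\mathrm{s}}}(\phi_{\mathrm{s}})$ is its probability density function.
   Context: The $N_{\mathrm{act}}$ satellites (the actual number of satellites) are on low circular orbits around Earth, all with the same inclination angle and the same altitude, so that they lie on a common spherical orbital shell concentric with Earth (Earth being approximated as a perfect sphere). Users are on the surface of Earth. The satellites of such a constellation are in general distributed unevenly along different latitudes; $\phi_{\mathrm{s}}$ is the latitude for which the effective number is computed. Satellite density means the number of satellites per unit surface area of the orbital shell, and $N_{\mathrm{eff}}$ is defined for every satellite latitude $\phi_{\mathrm{s}}$ in order to compensate for the uneven density of the actual constellation when it is modeled by satellites distributed uniformly on the orbital shell.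
   Formalization: The probability density function of the satellite latitude is assumed continuous at the latitude φ_s (its value at a single point is otherwise not determined), and the poles, where cos φ_s = 0, are excluded. *)

theory Defs
  imports "HOL-Probability.Probability"
begin

(* Positions are vectors in real^3. The origin is the centre of the Earth and the third
   coordinate axis is the rotation axis. Angles are in radians. *)

definition latitude :: "real^3 \<Rightarrow> real" where
  "latitude x = arcsin (x $ 3 / norm x)"

(* A circular orbit is given by the unit normal n of its orbital plane; the inclination is the
   angle between n and the rotation axis. *)
definition inclined_circular_orbits :: "real \<Rightarrow> real \<Rightarrow> (real^3) set set" where
  "inclined_circular_orbits R \<iota> =
     {{x. norm x = R \<and> x \<bullet> n = 0} | n :: real^3. norm n = 1 \<and> n $ 3 = cos \<iota>}"

(* X i is the random position, at the time of observation, of satellite i. The orbit on which a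
   satellite is found may be random. Independence of the satellites is not required. *)
definition inclined_constellation ::
    "'w measure \<Rightarrow> real \<Rightarrow> real \<Rightarrow> nat \<Rightarrow> (nat \<Rightarrow> 'w \<Rightarrow> real^3) \<Rightarrow> bool" where
  "inclined_constellation M R \<iota> N X \<longleftrightarrow>
     prob_space M \<and>
     (\<forall>i<N. X i \<in> borel_measurable M \<and>
        (\<forall>\<omega>\<in>space M. \<exists>C\<in>inclined_circular_orbits R \<iota>. X i \<omega> \<in> C))"

definition shell_point :: "real \<Rightarrow> real \<times> real \<Rightarrow> real^3" where
  "shell_point R = (\<lambda>(\<phi>, \<theta>).
     vector [R * cos \<phi> * cos \<theta>, R * cos \<phi> * sin \<theta>, R * sin \<phi>])"

(* Surface area on the sphere of radius R: R^2 cos \<phi> is the norm of the cross product of the two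
   partial derivatives of the parametrisation by latitude \<phi> and longitude \<theta>. *)
definition shell_surface :: "real \<Rightarrow> (real^3) measure" where
  "shell_surface R =
     distr (density lborel (\<lambda>(\<phi>, \<theta>).
              ennreal (indicator ({-(pi/2)..pi/2} \<times> {-pi..<pi}) (\<phi>, \<theta>) * (R\<^sup>2 * cos \<phi>))))
           borel (shell_point R)"

definition surface_area :: "real \<Rightarrow> (real^3) set \<Rightarrow> real" where
  "surface_area R A = measure (shell_surface R) A"

definition latitude_zone :: "real \<Rightarrow> real \<Rightarrow> real \<Rightarrow> (real^3) set" where
  "latitude_zone R a b = {x \<in> sphere 0 R. a \<le> latitude x \<and> latitude x \<le> b}"

definition expected_count ::
    "'w measure \<Rightarrow> nat \<Rightarrow> (nat \<Rightarrow> 'w \<Rightarrow> real^3) \<Rightarrow> (real^3) set \<Rightarrow> real" where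
  "expected_count M N X A = (LINT \<omega>|M. real (card {i. i < N \<and> X i \<omega> \<in> A}))"

(* The density at latitude \<phi> is the limit, over all zones a \<le> \<phi> \<le> b with a < b that shrink to the
   circle of latitude \<phi>, of the expected number of satellites per unit area in the zone. *)
definition has_satellite_density ::
    "'w measure \<Rightarrow> real \<Rightarrow> nat \<Rightarrow> (nat \<Rightarrow> 'w \<Rightarrow> real^3) \<Rightarrow> real \<Rightarrow> real \<Rightarrow> bool" where
  "has_satellite_density M R N X \<phi> d \<longleftrightarrow>
     ((\<lambda>(a, b). expected_count M N X (latitude_zone R a b) / surface_area R (latitude_zone R a b))
        \<longlongrightarrow> d) (at (\<phi>, \<phi>) within {(a, b). a \<le> \<phi> \<and> \<phi> \<le> b \<and> a < b})"

definition satellite_density ::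
    "'w measure \<Rightarrow> real \<Rightarrow> nat \<Rightarrow> (nat \<Rightarrow> 'w \<Rightarrow> real^3) \<Rightarrow> real \<Rightarrow> real" where
  "satellite_density M R N X \<phi> = (THE d. has_satellite_density M R N X \<phi> d)"

(* The size of a constellation whose density equals the one at latitude \<phi> on the whole shell. *)
definition effective_number ::
    "'w measure \<Rightarrow> real \<Rightarrow> nat \<Rightarrow> (nat \<Rightarrow> 'w \<Rightarrow> real^3) \<Rightarrow> real \<Rightarrow> real" where
  "effective_number M R N X \<phi> = satellite_density M R N X \<phi> * surface_area R (sphere 0 R)"

end

theory Submission
  imports Defs
begin

text \<open>
  By linearity of expectation, the expected number of satellites in the zone \<open>a \<le> \<phi> \<le> b\<close> is
  \<open>N_act\<close> times the integral of the density \<open>f\<close> over \<open>[a, b]\<close>, whatever the joint distribution of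
  the satellites. The area of the zone is \<open>2 * pi * R\<^sup>2\<close> times the integral of \<open>cos\<close> over the same
  interval. Dividing both integrals by \<open>b - a\<close> turns them into averages of functions continuous at
  \<open>\<phi>\<^sub>s\<close>, so the density is \<open>N_act * f \<phi>\<^sub>s / (2 * pi * R\<^sup>2 * cos \<phi>\<^sub>s)\<close>; multiplying it by the area
  \<open>4 * pi * R\<^sup>2\<close> of the whole sphere gives the formula.
\<close>

section \<open>Averages over intervals shrinking to a point\<close>

lemma shrinking_intervals_filter_nontrivial:
  fixes x :: real
  shows "at (x, x) within {(a, b). a \<le> x \<and> x \<le> b \<and> a < b} \<noteq> bot"
proof -
  have "\<exists>y\<in>{(a, b). a \<le> x \<and> x \<le> b \<and> a < b}. y \<noteq> (x, x) \<and> dist y (x, x) < e" if "e > 0" for e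
    by (rule bexI[of _ "(x, x + e / 2)"]) (use that in \<open>auto simp: dist_Pair_Pair dist_real_def\<close>)
  then show ?thesis
    by (auto simp: trivial_limit_within islimpt_approachable)
qed

text \<open>Near \<open>x\<close> all values of \<open>g\<close> lie close to \<open>g x\<close>,
  and averaging preserves two-sided bounds. Continuity at the single point \<open>x\<close> is
  enough, so no antiderivative is involved.\<close>

lemma interval_average_tendsto:
  fixes g :: "real \<Rightarrow> real"
  assumes int: "\<And>a b. set_integrable lborel {a..b} g" and cont: "isCont g x"
  shows "((\<lambda>(a, b). (LINT t:{a..b}|lborel. g t) / (b - a)) \<longlongrightarrow> g x)
           (at (x, x) within {(a, b). a \<le> x \<and> x \<le> b \<and> a < b})"
proof (rule tendstoI)
  fix e :: real
  assume "e > 0"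
  \<comment> \<open>Half of \<open>e\<close> is kept in reserve: integration yields only non-strict
    bounds, while the limit asks for a strict one.\<close>
  with cont obtain d where d: "d > 0" "\<And>t. dist t x < d \<Longrightarrow> dist (g t) (g x) < e / 2"
    unfolding continuous_at_eps_delta by (meson half_gt_zero)
  have "dist ((LINT t:{a..b}|lborel. g t) / (b - a)) (g x) < e"
    if ab: "a \<le> x" "x \<le> b" "a < b" and near: "dist (a, b) (x, x) < d" for a b
  proof -
    have "dist a x < d" "dist b x < d"
      using dist_fst_le[of "(a, b)" "(x, x)"] dist_snd_le[of "(a, b)" "(x, x)"] near by auto
    then have "dist (g t) (g x) < e / 2" if "t \<in> {a..b}" for t
      using that ab by (intro d(2)) (auto simp: dist_real_def)
    then have bounds: "g x - e / 2 \<le> g t" "g t \<le> g x + e / 2" if "t \<in> {a..b}" for t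
      using that by (force simp: dist_real_def abs_if split: if_splits)+
    have const: "set_integrable lborel {a..b} (\<lambda>t. c)" for c :: real
      by (rule borel_integrable_atLeastAtMost') simp
    have const_int: "(LINT t:{a..b}|lborel. c) = c * (b - a)" for c :: real
      using ab by (simp add: set_lebesgue_integral_def)
    have "(g x - e / 2) * (b - a) \<le> (LINT t:{a..b}|lborel. g t)"
      unfolding const_int[symmetric] by (intro set_integral_mono const int bounds(1))
    moreover have "(LINT t:{a..b}|lborel. g t) \<le> (g x + e / 2) * (b - a)"
      unfolding const_int[symmetric] by (intro set_integral_mono const int bounds(2))
    ultimately have "g x - e / 2 \<le> (LINT t:{a..b}|lborel. g t) / (b - a)"
      "(LINT t:{a..b}|lborel. g t) / (b - a) \<le> g x + e / 2"
      using ab by (simp_all add: pos_le_divide_eq pos_divide_le_eq)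
    with \<open>e > 0\<close> show ?thesis
      unfolding dist_real_def by linarith
  qed
  with d(1) show "\<forall>\<^sub>F p in at (x, x) within {(a, b). a \<le> x \<and> x \<le> b \<and> a < b}.
      dist (case p of (a, b) \<Rightarrow> (LINT t:{a..b}|lborel. g t) / (b - a)) (g x) < e"
    unfolding eventually_at by (intro exI[of _ d]) auto
qed

section \<open>Latitude and area on the spherical shell\<close>

lemma shell_point_alt:
  "shell_point R p = (R * cos (fst p) * cos (snd p)) *\<^sub>R axis 1 1
     + (R * cos (fst p) * sin (snd p)) *\<^sub>R axis 2 1 + (R * sin (fst p)) *\<^sub>R axis 3 1"
  by (cases p) (simp add: shell_point_def vec_eq_iff forall_3 axis_def)

lemma shell_point_measurable [measurable]: "shell_point R \<in> borel_measurable borel"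
  \<comment> \<open>Written as a sum of continuous multiples of the axis vectors, the
    parametrisation is visibly continuous.\<close>
  by (rule borel_measurable_continuous_onI) (unfold shell_point_alt, intro continuous_intros)

lemma norm_shell_point:
  assumes "R > 0"
  shows "norm (shell_point R (\<phi>, \<theta>)) = R"
proof -
  have "(R * cos \<phi> * cos \<theta>)\<^sup>2 + (R * cos \<phi> * sin \<theta>)\<^sup>2 + (R * sin \<phi>)\<^sup>2
      = R\<^sup>2 * ((cos \<phi>)\<^sup>2 * ((cos \<theta>)\<^sup>2 + (sin \<theta>)\<^sup>2) + (sin \<phi>)\<^sup>2)"
    by algebra
  also have "\<dots> = R\<^sup>2"
    by simp
  finally show ?thesis
    using assms by (simp add: norm_vec_def L2_set_def sum_3 shell_point_def)
qed

lemma latitude_shell_point: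
  assumes "R > 0" "\<phi> \<in> {-(pi/2)..pi/2}"
  shows "latitude (shell_point R (\<phi>, \<theta>)) = \<phi>"
  using assms norm_shell_point[of R \<phi> \<theta>] by (simp add: latitude_def shell_point_def arcsin_sin)

lemma component_div_norm_bounds:
  fixes x :: "real^'n"
  shows "- 1 \<le> x $ i / norm x" "x $ i / norm x \<le> 1"
proof -
  \<comment> \<open>At the origin the quotient is 0 by the convention for division by zero, so the
    bound holds there too.\<close>
  have "\<bar>x $ i / norm x\<bar> \<le> 1"
    using component_le_norm_cart[of x i] by (auto simp: divide_le_eq_1)
  then show "- 1 \<le> x $ i / norm x" "x $ i / norm x \<le> 1"
    by linarith+
qed

lemma latitude_bounds: "- (pi / 2) \<le> latitude x" "latitude x \<le> pi / 2"
  unfolding latitude_def using arcsin_bounded component_div_norm_bounds by blast+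

text \<open>On the sphere the norm is a nonzero constant, so \<open>latitude\<close> is continuous
  there and the zone is closed.\<close>

lemma latitude_zone_borel [measurable]:
  assumes "R > 0"
  shows "latitude_zone R a b \<in> sets borel"
proof -
  have "continuous_on (sphere 0 R) latitude"
    unfolding latitude_def using assms component_div_norm_bounds(1)
    by (intro continuous_intros) (auto intro: order_trans[OF abs_ge_self component_le_norm_cart])
  then have "closed (sphere 0 R \<inter> latitude -` {a..b})"
    by (intro continuous_closed_preimage) auto
  moreover have "latitude_zone R a b = sphere 0 R \<inter> latitude -` {a..b}"
    by (auto simp: latitude_zone_def)
  ultimately show ?thesis
    by simp
qed

text \<open>In the coordinates of \<open>shell_point\<close> the zone is a rectangle, so Tonelli
  splits its area into a latitude integral and the longitude range \<open>2 * pi\<close>. The bounds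
  on \<open>a\<close> and \<open>b\<close> keep the rectangle inside the parameter domain.\<close>

lemma surface_area_latitude_zone:
  assumes "R > 0" "- (pi / 2) \<le> a" "b \<le> pi / 2"
  shows "surface_area R (latitude_zone R a b) = 2 * pi * R\<^sup>2 * (LINT \<phi>:{a..b}|lborel. cos \<phi>)"
proof -
  have [measurable]: "latitude_zone R a b \<in> sets borel"
    using assms by simp
  \<comment> \<open>Since \<open>ennreal\<close> truncates negative reals to 0, this sign condition
    is what lets the nonnegative integral become a real one.\<close>
  have cos_nonneg: "0 \<le> indicator {a..b} \<phi> * cos \<phi>" for \<phi>
    using assms by (auto simp: indicator_def intro!: cos_ge_zero)
  have "set_integrable lborel {a..b} cos"
    by (intro borel_integrable_atLeastAtMost' continuous_intros)
  then have int: "integrable lborel (\<lambda>\<phi>. R\<^sup>2 * (indicator {a..b} \<phi> * cos \<phi>))"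
    by (simp add: set_integrable_def)
  have zone: "indicator (latitude_zone R a b) (shell_point R (\<phi>, \<theta>)) = indicator {a..b} \<phi>"
    if "\<phi> \<in> {-(pi/2)..pi/2}" for \<phi> \<theta>
    using assms that
    by (simp add: indicator_def latitude_zone_def norm_shell_point latitude_shell_point)
  have "emeasure (shell_surface R) (latitude_zone R a b) =
      emeasure (density lborel (\<lambda>(\<phi>, \<theta>).
        ennreal (indicator ({-(pi/2)..pi/2} \<times> {-pi..<pi}) (\<phi>, \<theta>) * (R\<^sup>2 * cos \<phi>))))
        (shell_point R -` latitude_zone R a b)"
    unfolding shell_surface_def by (subst emeasure_distr) (simp_all add: space_density)
  also have "\<dots> = (\<integral>\<^sup>+p. (case p of (\<phi>, \<theta>) \<Rightarrow>
        ennreal (indicator ({-(pi/2)..pi/2} \<times> {-pi..<pi}) (\<phi>, \<theta>) * (R\<^sup>2 * cos \<phi>)))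
        * indicator (latitude_zone R a b) (shell_point R p) \<partial>lborel)"
  proof (subst emeasure_density)
    show "shell_point R -` latitude_zone R a b \<in> sets lborel"
      using measurable_sets[OF shell_point_measurable, of "latitude_zone R a b" R] by simp
  qed (simp_all add: indicator_vimage borel_prod[symmetric])
  also have "\<dots> = (\<integral>\<^sup>+p. ennreal (R\<^sup>2 * (indicator {a..b} (fst p) * cos (fst p)))
        * indicator {-pi..<pi} (snd p) \<partial>(lborel \<Otimes>\<^sub>M lborel))"
    unfolding lborel_prod
  proof (rule nn_integral_cong)
    fix p :: "real \<times> real"
    obtain \<phi> \<theta> where p: "p = (\<phi>, \<theta>)" by fastforce
    show "(case p of (\<phi>, \<theta>) \<Rightarrow>
        ennreal (indicator ({-(pi/2)..pi/2} \<times> {-pi..<pi}) (\<phi>, \<theta>) * (R\<^sup>2 * cos \<phi>)))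
        * indicator (latitude_zone R a b) (shell_point R p) =
        ennreal (R\<^sup>2 * (indicator {a..b} (fst p) * cos (fst p))) * indicator {-pi..<pi} (snd p)"
    \<comment> \<open>Outside the parameter range both sides vanish: the left through the indicator
      in the density, the right because \<open>{a..b}\<close> lies within that range.\<close>
    proof (cases "\<phi> \<in> {-(pi/2)..pi/2}")
      case True
      then show ?thesis
        by (simp add: p zone indicator_times) (auto simp: indicator_def)
    next
      case False
      then have "\<phi> \<notin> {a..b}" using assms by auto
      with False show ?thesis by (simp add: p indicator_times)
    qed
  qed
  also have "\<dots> = (\<integral>\<^sup>+\<phi>. \<integral>\<^sup>+\<theta>. ennreal (R\<^sup>2 * (indicator {a..b} \<phi> * cos \<phi>))
        * indicator {-pi..<pi} \<theta> \<partial>lborel \<partial>lborel)"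
    by (subst lborel.nn_integral_fst[symmetric]) simp_all
  also have "\<dots> = (\<integral>\<^sup>+\<phi>. ennreal (R\<^sup>2 * (indicator {a..b} \<phi> * cos \<phi>)) \<partial>lborel) * ennreal (2 * pi)"
    by (simp add: nn_integral_cmult nn_integral_multc)
  also have "(\<integral>\<^sup>+\<phi>. ennreal (R\<^sup>2 * (indicator {a..b} \<phi> * cos \<phi>)) \<partial>lborel) =
      ennreal (R\<^sup>2 * (LINT \<phi>:{a..b}|lborel. cos \<phi>))"
    using int cos_nonneg by (subst nn_integral_eq_integral) (auto simp: set_lebesgue_integral_def)
  finally show ?thesis
    using cos_nonneg unfolding surface_area_def measure_def
    by (simp add: enn2real_mult set_lebesgue_integral_def)
qed

text \<open>The sphere is the zone from pole to pole, over which \<open>cos\<close> integrates to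
  2.\<close>

lemma surface_area_sphere:
  assumes "R > 0"
  shows "surface_area R (sphere 0 R) = 4 * pi * R\<^sup>2"
proof -
  have "latitude_zone R (- (pi / 2)) (pi / 2) = sphere 0 R"
    using latitude_bounds by (auto simp: latitude_zone_def)
  moreover have "(LINT \<phi>:{-(pi/2)..pi/2}|lborel. cos \<phi>) = sin (pi / 2) - sin (- (pi / 2))"
    unfolding set_lebesgue_integral_def
    by (rule integral_FTC_atLeastAtMost)
      (auto intro!: derivative_eq_intros continuous_intros
        simp: has_real_derivative_iff_has_vector_derivative[symmetric])
  ultimately show ?thesis
    using surface_area_latitude_zone[of R "- (pi / 2)" "pi / 2"] assms by simp
qed

section \<open>Expected counts and probability densities\<close>

lemma (in prob_space) expected_count_eq_sum_prob:
  assumes "\<And>i. i < N \<Longrightarrow> X i -` A \<inter> space M \<in> events"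
  shows "expected_count M N X A = (\<Sum>i<N. prob (X i -` A \<inter> space M))"
proof -
  have "expected_count M N X A = expectation (\<lambda>\<omega>. \<Sum>i<N. indicator (X i -` A \<inter> space M) \<omega>)"
    unfolding expected_count_def
  proof (rule Bochner_Integration.integral_cong)
    fix \<omega> assume "\<omega> \<in> space M"
    then have "(\<Sum>i<N. indicator (X i -` A \<inter> space M) \<omega>) = (\<Sum>i<N. of_bool (X i \<omega> \<in> A) :: real)"
      by (intro sum.cong) (auto simp: indicator_def)
    also have "\<dots> = real (card {i. i < N \<and> X i \<omega> \<in> A})"
      by (simp add: of_bool_def sum.If_cases Int_def)
    finally show "real (card {i. i < N \<and> X i \<omega> \<in> A}) =
        (\<Sum>i<N. indicator (X i -` A \<inter> space M) \<omega>)" ..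
  qed simp
  also have "\<dots> = (\<Sum>i<N. prob (X i -` A \<inter> space M))"
    using assms by (subst Bochner_Integration.integral_sum) (auto simp: emeasure_eq_measure)
  finally show ?thesis .
qed

text \<open>Transferred to \<open>M\<close>, the integrand becomes the indicator of the event that
  \<open>Y\<close> falls in \<open>A\<close>, which is bounded on a probability space.\<close>

lemma (in prob_space) set_integrable_pdf:
  fixes f :: "'b \<Rightarrow> real"
  assumes "distributed M L Y (\<lambda>x. ennreal (f x))" "\<And>x. f x \<ge> 0" "A \<in> sets L"
  shows "set_integrable L A f"
proof -
  have [measurable]: "Y \<in> measurable M L"
    using assms(1) by (rule distributed_measurable)
  have "integrable M (\<lambda>\<omega>. indicator A (Y \<omega>) :: real)"
    using assms(3) by (intro integrable_const_bound[of _ 1]) auto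
  then show ?thesis
    using distributed_integrable[OF assms(1), of "indicator A"] assms
    by (simp add: set_integrable_def mult.commute)
qed

lemma (in prob_space) prob_eq_set_integral_pdf:
  fixes f :: "'b \<Rightarrow> real"
  assumes "distributed M L Y (\<lambda>x. ennreal (f x))" "\<And>x. f x \<ge> 0" "A \<in> sets L"
  shows "prob (Y -` A \<inter> space M) = (LINT x:A|L. f x)"
proof -
  have "(LINT x:A|L. f x) = expectation (\<lambda>\<omega>. indicator A (Y \<omega>))"
    using distributed_integral[OF assms(1), of "indicator A"] assms
    by (simp add: set_lebesgue_integral_def mult.commute)
  also have "\<dots> = expectation (indicator (Y -` A \<inter> space M))"
    by (rule Bochner_Integration.integral_cong) (auto simp: indicator_def)
  finally show ?thesis
    by simp
qed

section \<open>Satellite density and effective number\<close>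

lemma has_satellite_density_unique:
  "has_satellite_density M R N X \<phi> d \<Longrightarrow> has_satellite_density M R N X \<phi> d' \<Longrightarrow> d = d'"
  \<comment> \<open>Arbitrarily short admissible intervals exist, so the filter is not
    \<open>bot\<close> and limits along it are unique.\<close>
  unfolding has_satellite_density_def
  using tendsto_unique[OF shrinking_intervals_filter_nontrivial] by blast

text \<open>Uniqueness of the limit resolves the \<open>THE\<close> in
  \<open>satellite_density\<close> as soon as one limit is exhibited.\<close>

lemma effective_number_eq:
  assumes "has_satellite_density M R N X \<phi> d"
  shows "effective_number M R N X \<phi> = d * surface_area R (sphere 0 R)"
proof -
  have "satellite_density M R N X \<phi> = d"
    unfolding satellite_density_def
    by (rule the_equality) (auto intro: has_satellite_density_unique assms)
  then show ?thesis
    by (simp add: effective_number_def)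
qed

lemma inclined_constellation_norm:
  assumes "inclined_constellation M R \<iota> N X" "i < N" "\<omega> \<in> space M"
  shows "norm (X i \<omega>) = R"
proof -
  obtain C where "C \<in> inclined_circular_orbits R \<iota>" "X i \<omega> \<in> C"
    using assms unfolding inclined_constellation_def by blast
  then show ?thesis
    unfolding inclined_circular_orbits_def by auto
qed

lemma expected_count_latitude_zone:
  assumes con: "inclined_constellation M R \<iota> N X" and "R > 0"
    and nonneg: "\<And>\<phi>. f \<phi> \<ge> 0"
    and pdf: "\<And>i. i < N \<Longrightarrow> distributed M lborel (\<lambda>\<omega>. latitude (X i \<omega>)) (\<lambda>\<phi>. ennreal (f \<phi>))"
  shows "expected_count M N X (latitude_zone R a b) = real N * (LINT \<phi>:{a..b}|lborel. f \<phi>)"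
proof -
  interpret prob_space M
    using con unfolding inclined_constellation_def by blast
  \<comment> \<open>Satellites always lie on the sphere, so membership in the zone is a condition on
    latitude alone.\<close>
  have zone: "X i -` latitude_zone R a b \<inter> space M = (\<lambda>\<omega>. latitude (X i \<omega>)) -` {a..b} \<inter> space M"
    if "i < N" for i
  proof (rule set_eqI)
    fix \<omega>
    show "\<omega> \<in> X i -` latitude_zone R a b \<inter> space M \<longleftrightarrow>
        \<omega> \<in> (\<lambda>\<omega>. latitude (X i \<omega>)) -` {a..b} \<inter> space M"
    proof (cases "\<omega> \<in> space M")
      case True
      then show ?thesis
        using inclined_constellation_norm[OF con that True] by (simp add: latitude_zone_def)
    qed simp
  qed
  have "expected_count M N X (latitude_zone R a b) =
      (\<Sum>i<N. prob (X i -` latitude_zone R a b \<inter> space M))"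
  proof (rule expected_count_eq_sum_prob)
    fix i assume "i < N"
    then show "X i -` latitude_zone R a b \<inter> space M \<in> events"
      using con \<open>R > 0\<close> unfolding inclined_constellation_def
      by (intro measurable_sets[of _ _ borel]) auto
  qed
  also have "\<dots> = (\<Sum>i<N. LINT \<phi>:{a..b}|lborel. f \<phi>)"
    by (intro sum.cong refl) (simp add: zone prob_eq_set_integral_pdf[OF pdf nonneg])
  finally show ?thesis
    by simp
qed

text \<open>Away from the poles \<open>cos \<phi>\<close> is positive, so the area per unit of
  latitude has a nonzero limit and the quotient rule for limits applies.\<close>

lemma has_satellite_density_pdf:
  assumes con: "inclined_constellation M R \<iota> N X" and "R > 0"
    and nonneg: "\<And>\<phi>. f \<phi> \<ge> 0"
    and pdf: "\<And>i. i < N \<Longrightarrow> distributed M lborel (\<lambda>\<omega>. latitude (X i \<omega>)) (\<lambda>\<phi>. ennreal (f \<phi>))"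
    and cont: "isCont f \<phi>" and \<phi>: "- (pi / 2) < \<phi>" "\<phi> < pi / 2"
  shows "has_satellite_density M R N X \<phi> (real N * f \<phi> / (2 * pi * R\<^sup>2 * cos \<phi>))"
proof -
  let ?F = "at (\<phi>, \<phi>) within {(a, b). a \<le> \<phi> \<and> \<phi> \<le> b \<and> a < b}"
  have cos_pos: "cos \<phi> > 0"
    using \<phi> by (intro cos_gt_zero_pi) auto
  have count: "((\<lambda>(a, b). expected_count M N X (latitude_zone R a b) / (b - a))
      \<longlongrightarrow> real N * f \<phi>) ?F"
  proof (cases "N = 0")
    case True
    then show ?thesis
      by (simp add: expected_count_def case_prod_unfold)
  next
    case False
    interpret prob_space M
      using con unfolding inclined_constellation_def by blast
    have "set_integrable lborel {a..b} f" for a b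
      using False pdf[of 0] nonneg by (intro set_integrable_pdf) auto
    from tendsto_mult_left[OF interval_average_tendsto[OF this cont], of "real N"] show ?thesis
      by (simp add: case_prod_unfold expected_count_latitude_zone[OF con \<open>R > 0\<close> nonneg pdf])
  qed
  have "set_integrable lborel {a..b} cos" for a b :: real
    by (intro borel_integrable_atLeastAtMost' continuous_intros)
  then have avg: "((\<lambda>(a, b). (LINT t:{a..b}|lborel. cos t) / (b - a)) \<longlongrightarrow> cos \<phi>) ?F"
    by (rule interval_average_tendsto) simp
  \<comment> \<open>The area formula holds only for intervals within the latitude range; as
    \<open>\<phi>\<close> is interior, this is eventually the case.\<close>
  have away_from_poles: "\<forall>\<^sub>F p in ?F. - (pi / 2) \<le> fst p \<and> snd p \<le> pi / 2"
  proof -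
    have "\<forall>\<^sub>F p in nhds (\<phi>, \<phi>). p \<in> {-(pi/2)<..<pi/2} \<times> {-(pi/2)<..<pi/2}"
      using \<phi> by (intro eventually_nhds_in_open open_Times) auto
    then have "\<forall>\<^sub>F p in nhds (\<phi>, \<phi>). - (pi / 2) \<le> fst p \<and> snd p \<le> pi / 2"
      by (rule eventually_mono) auto
    then show ?thesis
      by (auto simp: eventually_at_filter elim: eventually_mono)
  qed
  have area: "((\<lambda>(a, b). surface_area R (latitude_zone R a b) / (b - a))
      \<longlongrightarrow> 2 * pi * R\<^sup>2 * cos \<phi>) ?F"
    using tendsto_mult_left[OF avg, of "2 * pi * R\<^sup>2"]
    by (rule Lim_transform_eventually)
      (use away_from_poles in eventually_elim,
        use \<open>R > 0\<close> in \<open>auto simp: surface_area_latitude_zone\<close>)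
  \<comment> \<open>Nonzero length lets the common divisor \<open>b - a\<close> cancel in the
    quotient of the two limits' functions.\<close>
  have distinct: "\<forall>\<^sub>F p in ?F. fst p < snd p"
    by (auto simp: eventually_at_filter intro!: always_eventually)
  show ?thesis
    unfolding has_satellite_density_def
    by (rule Lim_transform_eventually[OF tendsto_divide[OF count area]])
      (use \<open>R > 0\<close> cos_pos distinct in \<open>auto elim!: eventually_mono\<close>)
qed

text \<open>The existence conjunct guarantees that the effective number rests on an actual limit and
  not on an unspecified value of \<open>THE\<close>.\<close>

theorem proposition3:
  fixes M :: "'w measure"
    and X :: "nat \<Rightarrow> 'w \<Rightarrow> real^3"
    and N_act :: nat
    and r_earth h \<iota> \<phi>\<^sub>s :: real
    and f :: "real \<Rightarrow> real"
  assumes radius: "r_earth > 0"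
    and altitude: "h > 0"
    and inclination: "0 \<le> \<iota>" "\<iota> \<le> pi"
    and constellation: "inclined_constellation M (r_earth + h) \<iota> N_act X"
    and pdf_nonneg: "\<And>\<phi>. f \<phi> \<ge> 0"
    and latitude_pdf:
      "\<And>i. i < N_act \<Longrightarrow> distributed M lborel (\<lambda>\<omega>. latitude (X i \<omega>)) (\<lambda>\<phi>. ennreal (f \<phi>))"
    and pdf_cont: "isCont f \<phi>\<^sub>s"
    and not_pole: "- (pi / 2) < \<phi>\<^sub>s" "\<phi>\<^sub>s < pi / 2"
  shows "(\<exists>d. has_satellite_density M (r_earth + h) N_act X \<phi>\<^sub>s d) \<and>
         effective_number M (r_earth + h) N_act X \<phi>\<^sub>s = 2 * f \<phi>\<^sub>s / cos \<phi>\<^sub>s * real N_act"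
proof -
  have R: "r_earth + h > 0"
    using radius altitude by simp
  have dens: "has_satellite_density M (r_earth + h) N_act X \<phi>\<^sub>s
      (real N_act * f \<phi>\<^sub>s / (2 * pi * (r_earth + h)\<^sup>2 * cos \<phi>\<^sub>s))"
    using constellation R pdf_nonneg latitude_pdf pdf_cont not_pole
    by (rule has_satellite_density_pdf)
  have "effective_number M (r_earth + h) N_act X \<phi>\<^sub>s = 2 * f \<phi>\<^sub>s / cos \<phi>\<^sub>s * real N_act"
    \<comment> \<open>The factor 2 is the ratio of the sphere's \<open>4 * pi\<close> to the
      \<open>2 * pi\<close> of a full turn in longitude; the squared radius cancels.\<close>
    using R unfolding effective_number_eq[OF dens] surface_area_sphere[OF R]
    by (simp add: divide_simps)
  with dens show ?thesis
    by blast
qed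

end
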